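(* Let $m,n,k$ be nonnegative integers and let $p$ be a positive integer such that $1\le p\le\min\{n,k\}$. Then $$\binom{m,\,n}{k}-\binom{m,\,n-p}{k-p}=2\sum_{i=1}^p\binom{m,\,n-i}{k-i+1}.$$
   Context: For nonnegative integers $m,n,k$, let $X$ be a set that is the disjoint union of blocks $X_1,\dots,X_n,Y$ with $|X_i|=2$ for $i=1,\dots,n$ and $|Y|=m$. The number $\binom{m,n}{k}$ is defined as the number of $(n+k)$-element subsets of $X$ that intersect each block $X_i$, $i=1,\dots,n$ (such subsets are called $(n+k)$-insets of $X$). *)

theory Defs
  imports Main "HOL-Library.Disjoint_Sets"
begin

definition block_system :: "nat \<Rightarrow> nat \<Rightarrow> (nat \<Rightarrow> 'a set) \<Rightarrow> 'a set \<Rightarrow> bool" where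
  "block_system m n B Y \<longleftrightarrow>
     (\<forall>i\<in>{1..n}. card (B i) = 2) \<and> finite Y \<and> card Y = m \<and>
     disjoint_family_on B {1..n} \<and> (\<forall>i\<in>{1..n}. B i \<inter> Y = {})"

definition insets :: "nat \<Rightarrow> nat \<Rightarrow> (nat \<Rightarrow> 'a set) \<Rightarrow> 'a set \<Rightarrow> 'a set set" where
  "insets n k B Y =
     {S. S \<subseteq> (\<Union>i\<in>{1..n}. B i) \<union> Y \<and> card S = n + k \<and> (\<forall>i\<in>{1..n}. S \<inter> B i \<noteq> {})}"

text \<open>
  A concrete block system in which the inset numbers are counted. The first component of a
  point names its block; index 0 is used for the block \<open>Y\<close>.
\<close>

definition std_block :: "nat \<Rightarrow> (nat \<times> nat) set" where
  "std_block i = {i} \<times> {0, 1}"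

definition std_rest :: "nat \<Rightarrow> (nat \<times> nat) set" where
  "std_rest m = {0} \<times> {..<m}"

definition inset_number :: "nat \<Rightarrow> nat \<Rightarrow> nat \<Rightarrow> nat" where
  "inset_number m n k = card (insets n k std_block (std_rest m))"

lemma block_system_std: "block_system m n std_block (std_rest m)"
  unfolding block_system_def std_block_def std_rest_def disjoint_family_on_def
  by (auto simp: card_cartesian_product)

text \<open>The number does not depend on the choice of the block system.\<close>

lemma block_system_isomorphic:
  assumes A: "block_system m n B Y" and C: "block_system m n B' Y'"
  shows "\<exists>f. inj_on f ((\<Union>i\<in>{1..n}. B i) \<union> Y) \<and> (\<forall>i\<in>{1..n}. f ` B i = B' i) \<and> f ` Y = Y'"
proof -
  have "\<exists>g. bij_betw g (B i) (B' i)" if "i \<in> {1..n}" for i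
  proof -
    have "card (B i) = 2" "card (B' i) = 2" using A C that unfolding block_system_def by blast+
    then show ?thesis by (metis card.infinite finite_same_card_bij zero_neq_numeral)
  qed
  then obtain g where g: "\<And>i. i \<in> {1..n} \<Longrightarrow> bij_betw (g i) (B i) (B' i)" by metis
  have "finite Y" "finite Y'" "card Y = card Y'"
    using A C unfolding block_system_def by simp_all
  then obtain h where h: "bij_betw h Y Y'"
    using finite_same_card_bij by blast
  define ix where "ix x = (THE i. i \<in> {1..n} \<and> x \<in> B i)" for x
  define f where "f x = (if x \<in> Y then h x else g (ix x) x)" for x
  have ix: "ix x = i" if "i \<in> {1..n}" "x \<in> B i" for x i
    unfolding ix_def
  proof (rule the_equality)
    show "i \<in> {1..n} \<and> x \<in> B i" using that by blast
    fix j assume j: "j \<in> {1..n} \<and> x \<in> B j"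
    have "disjoint_family_on B {1..n}" using A unfolding block_system_def by blast
    then show "j = i" using that j unfolding disjoint_family_on_def by blast
  qed
  have fB: "f x = g i x" if "i \<in> {1..n}" "x \<in> B i" for x i
  proof -
    have "x \<notin> Y" using A that unfolding block_system_def by blast
    then show ?thesis using ix[OF that] by (simp add: f_def)
  qed
  have fB': "f ` B i = B' i" if "i \<in> {1..n}" for i
    using g[OF that] fB[OF that] by (auto simp: bij_betw_def)
  have fY: "f ` Y = Y'" using h by (auto simp: bij_betw_def f_def)
  have injB: "inj_on f (B i)" if "i \<in> {1..n}" for i
    using g[OF that] fB[OF that] by (auto simp: bij_betw_def inj_on_def)
  have injY: "inj_on f Y" using h by (auto simp: bij_betw_def inj_on_def f_def)
  have d1: "B' i \<inter> B' j = {}" if "i \<in> {1..n}" "j \<in> {1..n}" "i \<noteq> j" for i j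
    using C that unfolding block_system_def disjoint_family_on_def by blast
  have d2: "B' i \<inter> Y' = {}" if "i \<in> {1..n}" for i
    using C that unfolding block_system_def by blast
  have "inj_on f ((\<Union>i\<in>{1..n}. B i) \<union> Y)"
  proof (rule inj_onI)
    fix x y
    assume x: "x \<in> (\<Union>i\<in>{1..n}. B i) \<union> Y" and y: "y \<in> (\<Union>i\<in>{1..n}. B i) \<union> Y"
      and e: "f x = f y"
    consider (YY) "x \<in> Y" "y \<in> Y"
      | (YB) i where "x \<in> Y" "i \<in> {1..n}" "y \<in> B i"
      | (BY) i where "y \<in> Y" "i \<in> {1..n}" "x \<in> B i"
      | (BB) i j where "i \<in> {1..n}" "x \<in> B i" "j \<in> {1..n}" "y \<in> B j"
      using x y by blast
    then show "x = y"
    proof cases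
      case YY
      then show ?thesis using injY e by (meson inj_onD)
    next
      case YB
      then have "f x \<in> Y'" "f y \<in> B' i" using fY fB' by blast+
      then show ?thesis using d2 YB e by auto
    next
      case BY
      then have "f y \<in> Y'" "f x \<in> B' i" using fY fB' by blast+
      then show ?thesis using d2 BY e by auto
    next
      case BB
      then have "f x \<in> B' i" "f y \<in> B' j" using fB' by blast+
      then have "i = j" using d1 BB e by (metis IntI empty_iff)
      then show ?thesis using injB[of i] BB e by (metis inj_onD)
    qed
  qed
  then show ?thesis using fB' fY by blast
qed

lemma card_insets_eq:
  assumes A: "block_system m n B Y"
  shows "card (insets n k B Y) = inset_number m n k"
proof -
  define X where "X = (\<Union>i\<in>{1..n}. B i) \<union> Y"
  define X' where "X' = (\<Union>i\<in>{1..n}. std_block i) \<union> std_rest m"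
  obtain f where f: "inj_on f X \<and> (\<forall>i\<in>{1..n}. f ` B i = std_block i) \<and> f ` Y = std_rest m"
    using block_system_isomorphic[OF A block_system_std] unfolding X_def ..
  have inj: "inj_on f X" using f by (elim conjE)
  have fB: "f ` B i = std_block i" if "i \<in> {1..n}" for i using f that by (elim conjE) (rule bspec)
  have fY: "f ` Y = std_rest m" using f by (elim conjE)
  have "f ` (\<Union>i\<in>{1..n}. B i) = (\<Union>i\<in>{1..n}. std_block i)"
    unfolding image_UN by (intro SUP_cong refl fB)
  then have fX: "f ` X = X'" unfolding X_def X'_def by (simp only: image_Un fY)
  have key: "f ` S \<in> insets n k std_block (std_rest m) \<longleftrightarrow> S \<in> insets n k B Y"
    if S: "S \<subseteq> X" for S
  proof -
    have "card (f ` S) = card S" using inj S by (intro card_image) (rule inj_on_subset)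
    moreover have "f ` S \<subseteq> X'" using image_mono[OF S, of f] by (simp only: fX)
    moreover have "f ` S \<inter> std_block i = f ` (S \<inter> B i)" if "i \<in> {1..n}" for i
    proof -
      have "B i \<subseteq> X" using that unfolding X_def by blast
      then show ?thesis by (simp only: inj_on_image_Int[OF inj S] fB[OF that])
    qed
    ultimately show ?thesis using S
      unfolding insets_def mem_Collect_eq X_def [symmetric] X'_def [symmetric]
      by (simp only: image_is_empty cong: ball_cong)
  qed
  have sub: "S \<subseteq> X" if "S \<in> insets n k B Y" for S
    using that unfolding insets_def X_def by (elim CollectE conjE)
  have "bij_betw ((`) f) (insets n k B Y) (insets n k std_block (std_rest m))"
    unfolding bij_betw_def
  proof
    show "inj_on ((`) f) (insets n k B Y)"
    proof (rule inj_onI)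
      fix S T assume "S \<in> insets n k B Y" "T \<in> insets n k B Y" "f ` S = f ` T"
      then show "S = T" using inj_on_image_eq_iff[OF inj, of S T] sub by blast
    qed
    show "(`) f ` insets n k B Y = insets n k std_block (std_rest m)"
    proof
      show "(`) f ` insets n k B Y \<subseteq> insets n k std_block (std_rest m)"
      proof (rule image_subsetI)
        fix S assume S: "S \<in> insets n k B Y"
        then show "f ` S \<in> insets n k std_block (std_rest m)" using key[OF sub[OF S]] by iprover
      qed
      show "insets n k std_block (std_rest m) \<subseteq> (`) f ` insets n k B Y"
      proof
        fix T assume T: "T \<in> insets n k std_block (std_rest m)"
        then have "T \<subseteq> f ` X" unfolding fX insets_def X'_def by (elim CollectE conjE)
        then obtain S where S: "S \<subseteq> X" and TS: "T = f ` S" by (rule subset_imageE)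
        have "S \<in> insets n k B Y" using key[OF S] T unfolding TS by iprover
        then show "T \<in> (`) f ` insets n k B Y" unfolding TS by (rule imageI)
      qed
    qed
  qed
  then show ?thesis unfolding inset_number_def by (rule bij_betw_same_card)
qed

end

theory Submission
  imports Defs
begin

text \<open>
  Fix \<open>m\<close> and write \<open>N(n, k)\<close> for the inset number. Sorting the insets by their trace on one
  two-element block gives the Pascal-type recurrence
  \<open>N(n+1, k+1) = 2 N(n, k+1) + N(n, k)\<close>: the trace is one of the two singletons, which leaves
  \<open>k+1\<close> surplus points for the other blocks and \<open>Y\<close>, or the whole block, which uses up one of
  the surplus points. (See \<open>bij_betw_insets_trace\<close> and \<open>card_insets_Suc_Suc\<close>.)

  The recurrence says that the step down the diagonal from \<open>(n-i+1, k-i+1)\<close> to \<open>(n-i, k-i)\<close>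
  lowers the inset number by exactly \<open>2 N(n-i, k-i+1)\<close>. Adding up \<open>p\<close> such steps, the decreases
  telescope to \<open>N(n, k) - N(n-p, k-p)\<close>.
\<close>

lemma block_system_last_disjoint:
  assumes "block_system m (Suc n) B Y"
  shows "B (Suc n) \<inter> ((\<Union>i\<in>{1..n}. B i) \<union> Y) = {}"
proof -
  have disj: "disjoint_family_on B {1..Suc n}" and Y: "B (Suc n) \<inter> Y = {}"
    using assms by (auto simp: block_system_def)
  have "B (Suc n) \<inter> B i = {}" if "i \<in> {1..n}" for i
    using disj that unfolding disjoint_family_on_def by force
  then show "B (Suc n) \<inter> ((\<Union>i\<in>{1..n}. B i) \<union> Y) = {}" using Y by blast
qed

lemma finite_block_system:
  assumes "block_system m n B Y"
  shows "finite ((\<Union>i\<in>{1..n}. B i) \<union> Y)"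
proof -
  have "finite (B i)" if "i \<in> {1..n}" for i
    using assms that unfolding block_system_def by (metis card.infinite zero_neq_numeral)
  then show ?thesis using assms by (auto simp: block_system_def)
qed

lemma finite_insets:
  assumes "block_system m n B Y"
  shows "finite (insets n k B Y)"
  using finite_subset[of _ "Pow ((\<Union>i\<in>{1..n}. B i) \<union> Y)"] finite_block_system[OF assms]
  by (auto simp: insets_def)

text \<open>
  Once the nonempty trace \<open>C\<close> on the last block is prescribed, the rest of the inset is an
  arbitrary inset of the remaining blocks. The size condition \<open>j + card C = Suc k\<close> records that
  one point of \<open>C\<close> pays for meeting the last block and the others count as surplus.
\<close>

lemma bij_betw_insets_trace:
  assumes bs: "block_system m (Suc n) B Y"
    and C: "C \<subseteq> B (Suc n)" "C \<noteq> {}" and size: "j + card C = Suc k"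
  shows "bij_betw (\<lambda>S. S \<union> C) (insets n j B Y)
           {S \<in> insets (Suc n) k B Y. S \<inter> B (Suc n) = C}"
proof (rule bij_betw_byWitness[where f' = "\<lambda>S. S - B (Suc n)"])
  define X where "X = (\<Union>i\<in>{1..n}. B i) \<union> Y"
  have disj: "B (Suc n) \<inter> X = {}"
    using block_system_last_disjoint[OF bs] by (simp add: X_def)
  have BX: "B i \<subseteq> X" if "i \<in> {1..n}" for i using that by (auto simp: X_def)
  have X_Suc: "(\<Union>i\<in>{1..Suc n}. B i) \<union> Y = X \<union> B (Suc n)"
    by (auto simp: X_def atLeastAtMostSuc_conv)
  have fin: "finite (X \<union> B (Suc n))"
    using finite_block_system[OF bs] by (simp only: X_Suc)
  have small: "S \<in> insets n j B Y \<longleftrightarrow>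
      S \<subseteq> X \<and> card S = n + j \<and> (\<forall>i\<in>{1..n}. S \<inter> B i \<noteq> {})" for S
    by (simp add: insets_def X_def)
  have large: "S \<in> insets (Suc n) k B Y \<longleftrightarrow>
      S \<subseteq> X \<union> B (Suc n) \<and> card S = Suc n + k \<and> (\<forall>i\<in>{1..n}. S \<inter> B i \<noteq> {}) \<and>
      S \<inter> B (Suc n) \<noteq> {}" for S
    unfolding insets_def X_Suc by (auto simp: atLeastAtMostSuc_conv)
  show "\<forall>S\<in>insets n j B Y. S \<union> C - B (Suc n) = S"
  proof
    fix S assume "S \<in> insets n j B Y"
    then have "S \<subseteq> X" by (simp add: small)
    then show "S \<union> C - B (Suc n) = S" using disj C(1) by blast
  qed
  show "\<forall>S\<in>{S \<in> insets (Suc n) k B Y. S \<inter> B (Suc n) = C}. S - B (Suc n) \<union> C = S"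
    by blast
  show "(\<lambda>S. S \<union> C) ` insets n j B Y \<subseteq> {S \<in> insets (Suc n) k B Y. S \<inter> B (Suc n) = C}"
  proof (rule image_subsetI)
    fix S assume S: "S \<in> insets n j B Y"
    have "S \<inter> C = {}" "S \<subseteq> X" using S C disj by (auto simp: small)
    then have "card (S \<union> C) = card S + card C"
      using fin C by (intro card_Un_disjoint) (auto intro: finite_subset)
    then have "card (S \<union> C) = Suc n + k" using S size by (simp add: small)
    moreover have "(S \<union> C) \<inter> B (Suc n) = C" using \<open>S \<subseteq> X\<close> C disj by blast
    ultimately show "S \<union> C \<in> {S \<in> insets (Suc n) k B Y. S \<inter> B (Suc n) = C}"
      using S C by (auto simp: small large)
  qed
  show "(\<lambda>S. S - B (Suc n)) ` {S \<in> insets (Suc n) k B Y. S \<inter> B (Suc n) = C} \<subseteq> insets n j B Y"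
  proof (rule image_subsetI)
    fix S assume "S \<in> {S \<in> insets (Suc n) k B Y. S \<inter> B (Suc n) = C}"
    then have S: "S \<in> insets (Suc n) k B Y" and trace: "S \<inter> B (Suc n) = C" by auto
    have "finite S" using S fin by (auto simp: large intro: finite_subset)
    then have "card (S - B (Suc n)) = card S - card C"
      using trace by (metis card_Diff_subset_Int finite_Int)
    then have "card (S - B (Suc n)) = n + j" using S size by (simp add: large)
    moreover have "(S - B (Suc n)) \<inter> B i \<noteq> {}" if "i \<in> {1..n}" for i
    proof -
      have "(S - B (Suc n)) \<inter> B i = S \<inter> B i" using BX[OF that] disj by blast
      then show ?thesis using S that by (simp add: large)
    qed
    ultimately show "S - B (Suc n) \<in> insets n j B Y"
      using S by (auto simp: small large)
  qed
qed

text \<open>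
  The three nonempty subsets of the last block are its possible traces, so the fibres of the
  trace map partition the insets into three families.
\<close>

lemma card_insets_Suc_Suc:
  assumes bs: "block_system m (Suc n) B Y"
  shows "card (insets (Suc n) (Suc k) B Y) =
         2 * card (insets n (Suc k) B Y) + card (insets n k B Y)"
proof -
  have "card (B (Suc n)) = 2" using bs by (auto simp: block_system_def)
  then obtain a b where ab: "B (Suc n) = {a, b}" "a \<noteq> b" by (auto simp: card_2_iff)
  define F where "F C = {S \<in> insets (Suc n) (Suc k) B Y. S \<inter> B (Suc n) = C}" for C
  have cardF: "card (F C) = card (insets n j B Y)"
    if "C \<subseteq> B (Suc n)" "C \<noteq> {}" "j + card C = Suc (Suc k)" for C j
    using bij_betw_same_card[OF bij_betw_insets_trace[OF bs that]] by (simp add: F_def)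
  have "S \<inter> B (Suc n) \<in> {{a}, {b}, {a, b}}" if "S \<in> insets (Suc n) (Suc k) B Y" for S
    using that by (auto simp: insets_def atLeastAtMostSuc_conv ab)
  then have "insets (Suc n) (Suc k) B Y = (\<Union>C\<in>{{a}, {b}, {a, b}}. F C)"
    by (auto simp: F_def)
  also have "card \<dots> = (\<Sum>C\<in>{{a}, {b}, {a, b}}. card (F C))"
  proof (rule card_UN_disjoint)
    show "\<forall>C\<in>{{a}, {b}, {a, b}}. finite (F C)"
      using finite_insets[OF bs] by (simp add: F_def)
  qed (auto simp: F_def)
  also have "\<dots> = card (F {a}) + card (F {b}) + card (F {a, b})"
    using ab(2) by (simp add: doubleton_eq_iff)
  also have "\<dots> = 2 * card (insets n (Suc k) B Y) + card (insets n k B Y)"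
    using cardF[of "{a}" "Suc k"] cardF[of "{b}" "Suc k"] cardF[of "{a, b}" k] ab by simp
  finally show ?thesis .
qed

lemma inset_number_Suc_Suc:
  "inset_number m (Suc n) (Suc k) = 2 * inset_number m n (Suc k) + inset_number m n k"
  using card_insets_Suc_Suc[OF block_system_std] by (simp add: inset_number_def)

theorem proposition3:
  fixes m n k p :: nat
  assumes "1 \<le> p" and "p \<le> min n k"
  shows "int (inset_number m n k) - int (inset_number m (n - p) (k - p)) =
         2 * (\<Sum>i = 1..p. int (inset_number m (n - i) (k - i + 1)))"
proof -
  define D where "D i = int (inset_number m (n - i) (k - i))" for i
  have step: "2 * int (inset_number m (n - Suc i) (k - Suc i + 1)) = D i - D (Suc i)"
    if "i < p" for i
  proof -
    have "n - i = Suc (n - Suc i)" "k - i = Suc (k - Suc i)" using that assms by auto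
    then show ?thesis
      using inset_number_Suc_Suc[of m "n - Suc i" "k - Suc i"] by (simp add: D_def)
  qed
  have "2 * (\<Sum>i = 1..p. int (inset_number m (n - i) (k - i + 1))) =
        (\<Sum>i<p. 2 * int (inset_number m (n - Suc i) (k - Suc i + 1)))"
    unfolding sum_distrib_left One_nat_def by (rule sum.atLeast1_atMost_eq)
  also have "\<dots> = (\<Sum>i<p. D i - D (Suc i))" by (intro sum.cong refl step) simp
  also have "\<dots> = D 0 - D p" by (rule sum_lessThan_telescope')
  finally show ?thesis by (simp add: D_def)
qed

end
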